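(* Let $\mathsf{A}$ be a recursively axiomatizable, sufficiently strong arithmetic theory in the signature $\langle 0,S,+,\times\rangle$, with provability predicate $\mathsf{Prov}_{\mathsf{A}}$. Then for every closed formula $\varphi$ of the language, $$\mathsf{A} \Vdash \mathsf{Prov}_{\mathsf{A}}(\ulcorner \varphi\urcorner)\to\varphi .$$
   Context: **Language.** First-order language over the finite signature $\langle 0,S,+,\times\rangle$, whose only constant is $0$ and whose atomic formulas are $t_1=t_2$; $=$ is treated as an ordinary binary predicate symbol, so the equality axioms used in derivations belong to the theory. Primitive logical constants: $\to,\land,\forall,\bot$ ($\bot$ is not an atomic formula). Abbreviations: $\neg\varphi:=\varphi\to\bot$, $\varphi\lor\psi:=\neg(\neg\varphi\land\neg\psi)$, $\exists x\,\varphi:=\neg\forall x\,\neg\varphi$. Numerals: $\bar 0=0$, $\overline{n}=S(\overline{n-1})$. $t<s$ abbreviates $\exists x(t+S(x)=s)$, and $\forall x<t\,\varphi$ abbreviates $\forall x(\exists y(x+S(y)=t)\to\varphi)$. A formula is $\Delta_0$ if all its quantifiers are bounded. **Bases.** An atomic rule is an inference figure with finitely many (possibly zero) premises $P_1,\dots,P_n$ and a conclusion $C$, all closed atomic formulas. A base $\mathfrak{B}$ is a set of atomic rules. $\vdash_{\mathfrak{B}} C$ means that there is a finite derivation tree with root $C$ built from rules of $\mathfrak{B}$: a premise-free rule with conclusion $C$ gives a derivation of $C$; if the rule from $P_1,\dots,P_n$ to $C$ is in $\mathfrak{B}$ and each $P_i$ has a $\mathfrak{B}$-derivation, these combine to a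 derivation of $C$. **Support.** For bases $\mathfrak{B},\mathfrak{C}$, closed formulas, and non-empty sets $\Delta$ of closed formulas: - $\Vdash_{\mathfrak{B}} P$ iff $\vdash_{\mathfrak{B}} P$, for $P$ a closed atom; - $\Vdash_{\mathfrak{B}}\varphi\land\psi$ iff $\Vdash_{\mathfrak{B}}\varphi$ and $\Vdash_{\mathfrak{B}}\psi$; - $\Vdash_{\mathfrak{B}}\varphi\to\psi$ iff $\varphi\Vdash_{\mathfrak{B}}\psi$; - $\Vdash_{\mathfrak{B}}\forall x\varphi$ iff $\Vdash_{\mathfrak{B}}\varphi[x\mapsto t]$ for all closed terms $t$; - $\Vdash_{\mathfrak{B}}\bot$ iff $\Vdash_{\mathfrak{B}}P$ for every closed atom $P$; - $\Delta\Vdash_{\mathfrak{B}}\varphi$ iff for all bases $\mathfrak{C}\supseteq\mathfrak{B}$, if $\Vdash_{\mathfrak{C}}\psi$ for all $\psi\in\Delta$, then $\Vdash_{\mathfrak{C}}\varphi$. **Validity.** For a set $\Gamma$ of closed formulas, $\Gamma\Vdash\varphi$ iff $\Gamma\Vdash_{\varnothing}\varphi$, where $\varnothing$ is the empty base. A theory $\mathsf{A}$ is identified with its set of axioms. **Theories.** $\vdash_{\mathsf{A}}\varphi$ means that $\varphi$ is derivable from the axioms of $\mathsf{A}$ in classical first-order logic. $\mathsf{A}$ is sufficiently strong if (i) for all $m,n\in\mathbb{N}$, $\vdash_{\mathsf{A}}\bar m=\bar n$ iff $m=n$; and (ii) for every $\Delta_0$-sentence $\delta$, $\vdash_{\mathsf{A}}\delta$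 or $\vdash_{\mathsf{A}}\neg\delta$. $\mathsf{A}$ is recursively axiomatizable if there is a primitive recursive function enumerating its axioms. **Provability predicate.** Derivations are finite sequences of formulas in a calculus with rules modus ponens and universal generalization (generalization without side conditions, or with them built into $\mathsf{Gen}$); the logical axioms of the calculus are counted among the axioms of $\mathsf{A}$. Fix an effective Gödel numbering $\ulcorner\cdot\urcorner$ and $\Delta_0$-formulas $\mathsf{Form}(x)$ ($x$ codes a formula), $\mathsf{Seq}(p,n)$ ($p$ codes a finite sequence of length $n$), $\mathsf{Elt}(p,i,y)$ ($y$ is the $i$-th element of the sequence coded by $p$, indexing from $0$), $\mathsf{Ax}_{\mathsf{A}}(x)$ ($x$ codes an axiom of $\mathsf{A}$), $\mathsf{MP}(a,b,c)$ ($c$ follows from $a$ and $b$ by modus ponens), $\mathsf{Gen}(a,c)$ ($c$ follows from $a$ by generalization). Put $$\mathsf{Line}(p,i):=\exists y\Big(\mathsf{Elt}(p,i,y)\land\mathsf{Form}(y)\land\big(\mathsf{Ax}_{\mathsf{A}}(y)\lor\exists j,k<i\,\exists y_1,y_2(\mathsf{Elt}(p,j,y_1)\land\mathsf{Elt}(p,k,y_2)\land\mathsf{MP}(y_1,y_2,y))\lor\exists j<i\,\exists y_1(\mathsf{Elt}(p,j,y_1)\land\mathsf{Gen}(y_1,y))\big)\Big),$$ $$\mathsf{Prf}_{\mathsf{A}}(p,x):=\mathsf{Form}(x)\land\exists n\big(\mathsf{Seq}(p,n)\land n>0\land\mathsf{Elt}(p,n-1,x)\land\forall i<n\,\mathsf{Line}(p,i)\big),$$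 $$\mathsf{Prov}_{\mathsf{A}}(x):=\exists p\,\mathsf{Prf}_{\mathsf{A}}(p,x),$$ where all quantifiers in $\mathsf{Line}$ and $\mathsf{Prf}_{\mathsf{A}}$ are understood as bounded, so both are $\Delta_0$. **Standing assumptions on the coding.** - Comp: $\vdash_{\mathsf{A}}\ulcorner\varphi\urcorner=\ulcorner\psi\urcorner$ iff $\varphi=\psi$ (codes being written as numerals). - Seq: for fixed $p,i$ there is at most one $y$ with $\mathsf{Elt}(p,i,y)$; if $\mathsf{Seq}(p,n)$ then for each $i<n$ there is exactly one such $y$ (provably in $\mathsf{A}$). - Rule: $\mathsf{A}$ proves the corresponding representability conditions: $\mathsf{Ax}_{\mathsf{A}}(\bar n)$ holds iff $n$ is the code of an axiom of $\mathsf{A}$; $\mathsf{MP}(\bar a,\bar b,\bar c)$ holds iff $a=\ulcorner\varphi\urcorner$, $b=\ulcorner\varphi\to\psi\urcorner$, $c=\ulcorner\psi\urcorner$ for some $\varphi,\psi$; $\mathsf{Gen}(\bar a,\bar c)$ holds iff $a=\ulcorner\varphi\urcorner$, $c=\ulcorner\forall x\,\varphi\urcorner$ for some $\varphi$, $x$. - Len and Pref: there is a primitive recursive function $\mathsf{Pref}(p,k)$ coding the initial segment of length $k$ of the sequence coded by $p$, with $\vdash_{\mathsf{A}}\mathsf{Seq}(\mathsf{Pref}(p,k),k)$ and $\vdash_{\mathsf{A}}\mathsf{Prf}_{\mathsf{A}}(p,\ulcorner\varphi\urcorner)\land\mathsf{Elt}(p,n,\ulcorner\psi\urcorner)\to\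mathsf{Prf}_{\mathsf{A}}(\mathsf{Pref}(p,n+1),\ulcorner\psi\urcorner)$.
   Formalization: "Arithmetic theory" is taken to include that A proves no Δ₀-sentence false in the natural numbers (true of every consistent extension of Robinson arithmetic); with conditions (i) and (ii) alone, + and × may be reinterpreted and the claim fails. *)

theory Defs
  imports Main "HOL-Library.Nat_Bijection"
begin

section \<open>Syntax\<close>

datatype tm = Var nat | Zero | Succ tm | Add tm tm | Mul tm tm

datatype fm = Eq tm tm | Fls | Con fm fm | Imp fm fm | Forall nat fm

primrec tvars :: "tm \<Rightarrow> nat set" where
  "tvars (Var x) = {x}"
| "tvars Zero = {}"
| "tvars (Succ t) = tvars t"
| "tvars (Add s t) = tvars s \<union> tvars t"
| "tvars (Mul s t) = tvars s \<union> tvars t"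

primrec fv :: "fm \<Rightarrow> nat set" where
  "fv (Eq s t) = tvars s \<union> tvars t"
| "fv Fls = {}"
| "fv (Con \<phi> \<psi>) = fv \<phi> \<union> fv \<psi>"
| "fv (Imp \<phi> \<psi>) = fv \<phi> \<union> fv \<psi>"
| "fv (Forall x \<phi>) = fv \<phi> - {x}"

definition closed_tm :: "tm \<Rightarrow> bool" where
  "closed_tm t \<longleftrightarrow> tvars t = {}"

definition sentence :: "fm \<Rightarrow> bool" where
  "sentence \<phi> \<longleftrightarrow> fv \<phi> = {}"

definition closed_atom :: "fm \<Rightarrow> bool" where
  "closed_atom P \<longleftrightarrow> (\<exists>s t. P = Eq s t) \<and> sentence P"

definition Neg :: "fm \<Rightarrow> fm" where
  "Neg \<phi> = Imp \<phi> Fls"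

definition Dis :: "fm \<Rightarrow> fm \<Rightarrow> fm" where
  "Dis \<phi> \<psi> = Neg (Con (Neg \<phi>) (Neg \<psi>))"

definition Exists :: "nat \<Rightarrow> fm \<Rightarrow> fm" where
  "Exists x \<phi> = Neg (Forall x (Neg \<phi>))"

primrec num :: "nat \<Rightarrow> tm" where
  "num 0 = Zero"
| "num (Suc n) = Succ (num n)"

text \<open>Simultaneous capture-avoiding substitution. A bound variable is renamed only if it
  occurs in a term substituted for a free variable in its scope; in particular, nothing is
  renamed when closed terms are substituted.\<close>

primrec tsub :: "(nat \<Rightarrow> tm) \<Rightarrow> tm \<Rightarrow> tm" where
  "tsub \<sigma> (Var x) = \<sigma> x"
| "tsub \<sigma> Zero = Zero"
| "tsub \<sigma> (Succ t) = Succ (tsub \<sigma> t)"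
| "tsub \<sigma> (Add s t) = Add (tsub \<sigma> s) (tsub \<sigma> t)"
| "tsub \<sigma> (Mul s t) = Mul (tsub \<sigma> s) (tsub \<sigma> t)"

definition bvar :: "(nat \<Rightarrow> tm) \<Rightarrow> nat \<Rightarrow> fm \<Rightarrow> nat" where
  "bvar \<sigma> x \<phi> =
     (let V = (\<Union>v \<in> fv \<phi> - {x}. tvars (\<sigma> v)) in if x \<in> V then (LEAST z. z \<notin> V) else x)"

primrec sub :: "(nat \<Rightarrow> tm) \<Rightarrow> fm \<Rightarrow> fm" where
  "sub \<sigma> (Eq s t) = Eq (tsub \<sigma> s) (tsub \<sigma> t)"
| "sub \<sigma> Fls = Fls"
| "sub \<sigma> (Con \<phi> \<psi>) = Con (sub \<sigma> \<phi>) (sub \<sigma> \<psi>)"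
| "sub \<sigma> (Imp \<phi> \<psi>) = Imp (sub \<sigma> \<phi>) (sub \<sigma> \<psi>)"
| "sub \<sigma> (Forall x \<phi>) = Forall (bvar \<sigma> x \<phi>) (sub (\<sigma>(x := Var (bvar \<sigma> x \<phi>))) \<phi>)"

abbreviation subst1 :: "fm \<Rightarrow> nat \<Rightarrow> tm \<Rightarrow> fm" where
  "subst1 \<phi> x t \<equiv> sub (Var(x := t)) \<phi>"

text \<open>A formula defining a \<open>k\<close>-ary relation has its free variables among \<open>0, \<dots>, k - 1\<close>;
  \<open>app \<phi> [t\<^sub>0, \<dots>]\<close> is its instance at the given arguments.\<close>

definition app :: "fm \<Rightarrow> tm list \<Rightarrow> fm" where
  "app \<phi> ts = sub (\<lambda>v. if v < length ts then ts ! v else Var v) \<phi>"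


section \<open>Bounded quantifiers and \<open>\<Delta>\<^sub>0\<close>-formulas\<close>

text \<open>In \<open>s < t\<close> the witness variable \<open>z\<close> is explicit; it is to be chosen fresh.\<close>

definition Less :: "nat \<Rightarrow> tm \<Rightarrow> tm \<Rightarrow> fm" where
  "Less z s t = Exists z (Eq (Add s (Succ (Var z))) t)"

definition Forall_less :: "nat \<Rightarrow> nat \<Rightarrow> tm \<Rightarrow> fm \<Rightarrow> fm" where
  "Forall_less z x t \<phi> = Forall x (Imp (Less z (Var x) t) \<phi>)"

definition Exists_less :: "nat \<Rightarrow> nat \<Rightarrow> tm \<Rightarrow> fm \<Rightarrow> fm" where
  "Exists_less z x t \<phi> = Neg (Forall_less z x t (Neg \<phi>))"

text \<open>The quantifier hidden in the abbreviation \<open>s < t\<close> counts as bounded (by \<open>t\<close>).\<close>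

inductive delta0 :: "fm \<Rightarrow> bool" where
  "delta0 (Eq s t)"
| "delta0 Fls"
| "z \<notin> tvars s \<union> tvars t \<Longrightarrow> delta0 (Less z s t)"
| "delta0 \<phi> \<Longrightarrow> delta0 \<psi> \<Longrightarrow> delta0 (Con \<phi> \<psi>)"
| "delta0 \<phi> \<Longrightarrow> delta0 \<psi> \<Longrightarrow> delta0 (Imp \<phi> \<psi>)"
| "x \<notin> tvars t \<Longrightarrow> z \<notin> tvars t \<Longrightarrow> z \<noteq> x \<Longrightarrow> delta0 \<phi> \<Longrightarrow> delta0 (Forall_less z x t \<phi>)"


section \<open>Bases, support and validity\<close>

type_synonym atomic_rule = "fm list \<times> fm"

definition is_base :: "atomic_rule set \<Rightarrow> bool" where
  "is_base B \<longleftrightarrow> (\<forall>(Ps, C) \<in> B. closed_atom C \<and> (\<forall>P \<in> set Ps. closed_atom P))"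

inductive base_derives :: "atomic_rule set \<Rightarrow> fm \<Rightarrow> bool" for B where
  "(Ps, C) \<in> B \<Longrightarrow> (\<forall>P \<in> set Ps. base_derives B P) \<Longrightarrow> base_derives B C"

primrec fsize :: "fm \<Rightarrow> nat" where
  "fsize (Eq s t) = 0"
| "fsize Fls = 0"
| "fsize (Con \<phi> \<psi>) = Suc (fsize \<phi> + fsize \<psi>)"
| "fsize (Imp \<phi> \<psi>) = Suc (fsize \<phi> + fsize \<psi>)"
| "fsize (Forall x \<phi>) = Suc (fsize \<phi>)"

lemma fsize_sub [simp]: "fsize (sub \<sigma> \<phi>) = fsize \<phi>"
  by (induction \<phi> arbitrary: \<sigma>) auto

function supports :: "atomic_rule set \<Rightarrow> fm \<Rightarrow> bool" where
  "supports B (Eq s t) \<longleftrightarrow> base_derives B (Eq s t)"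
| "supports B Fls \<longleftrightarrow> (\<forall>P. closed_atom P \<longrightarrow> base_derives B P)"
| "supports B (Con \<phi> \<psi>) \<longleftrightarrow> supports B \<phi> \<and> supports B \<psi>"
| "supports B (Imp \<phi> \<psi>) \<longleftrightarrow>
     (\<forall>C. is_base C \<and> B \<subseteq> C \<longrightarrow> supports C \<phi> \<longrightarrow> supports C \<psi>)"
| "supports B (Forall x \<phi>) \<longleftrightarrow> (\<forall>t. closed_tm t \<longrightarrow> supports B (subst1 \<phi> x t))"
  by pat_completeness auto
termination
  by (relation "measure (\<lambda>(B, \<phi>). fsize \<phi>)") auto

definition entails :: "fm set \<Rightarrow> atomic_rule set \<Rightarrow> fm \<Rightarrow> bool" where
  "entails \<Delta> B \<phi> \<longleftrightarrow>
     (\<forall>C. is_base C \<and> B \<subseteq> C \<longrightarrow> (\<forall>\<psi> \<in> \<Delta>. supports C \<psi>) \<longrightarrow> supports C \<phi>)"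

definition valid :: "fm set \<Rightarrow> fm \<Rightarrow> bool" where
  "valid \<Gamma> \<phi> \<longleftrightarrow> entails \<Gamma> {} \<phi>"


section \<open>Derivability\<close>

text \<open>Equality is an ordinary predicate symbol: there are no logical axioms for it.\<close>

inductive_set logical_axioms :: "fm set" where
  "Imp \<phi> (Imp \<psi> \<phi>) \<in> logical_axioms"
| "Imp (Imp \<phi> (Imp \<psi> \<chi>)) (Imp (Imp \<phi> \<psi>) (Imp \<phi> \<chi>)) \<in> logical_axioms"
| "Imp \<phi> (Imp \<psi> (Con \<phi> \<psi>)) \<in> logical_axioms"
| "Imp (Con \<phi> \<psi>) \<phi> \<in> logical_axioms"
| "Imp (Con \<phi> \<psi>) \<psi> \<in> logical_axioms"
| "Imp (Neg (Neg \<phi>)) \<phi> \<in> logical_axioms"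
| "Imp (Forall x \<phi>) (subst1 \<phi> x t) \<in> logical_axioms"
| "x \<notin> fv \<phi> \<Longrightarrow> Imp (Forall x (Imp \<phi> \<psi>)) (Imp \<phi> (Forall x \<psi>)) \<in> logical_axioms"

definition axioms_of :: "fm set \<Rightarrow> fm set" where
  "axioms_of A = A \<union> logical_axioms"

inductive proves :: "fm set \<Rightarrow> fm \<Rightarrow> bool" (infix \<open>\<turnstile>\<close> 50) for A where
  ax: "\<phi> \<in> axioms_of A \<Longrightarrow> A \<turnstile> \<phi>"
| mp: "A \<turnstile> \<phi> \<Longrightarrow> A \<turnstile> Imp \<phi> \<psi> \<Longrightarrow> A \<turnstile> \<psi>"
| gen: "A \<turnstile> \<phi> \<Longrightarrow> A \<turnstile> Forall x \<phi>"


section \<open>Recursive functions and effective numberings\<close>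

inductive primrec_fn :: "nat \<Rightarrow> (nat list \<Rightarrow> nat) \<Rightarrow> bool" where
  "primrec_fn n (\<lambda>xs. 0)"
| "primrec_fn 1 (\<lambda>xs. Suc (xs ! 0))"
| "i < n \<Longrightarrow> primrec_fn n (\<lambda>xs. xs ! i)"
| "primrec_fn (length gs) f \<Longrightarrow> (\<forall>g \<in> set gs. primrec_fn n g) \<Longrightarrow>
     primrec_fn n (\<lambda>xs. f (map (\<lambda>g. g xs) gs))"
| "primrec_fn n f \<Longrightarrow> primrec_fn (Suc (Suc n)) g \<Longrightarrow>
     primrec_fn (Suc n)
       (\<lambda>xs. rec_nat (f (tl xs)) (\<lambda>k r. g (k # r # tl xs)) (hd xs))"

text \<open>Total recursive functions, by minimisation of regular functions. Closing under primitive
  recursion as well would add nothing, by the normal form theorem.\<close>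

inductive recursive_fn :: "nat \<Rightarrow> (nat list \<Rightarrow> nat) \<Rightarrow> bool" where
  "primrec_fn n f \<Longrightarrow> recursive_fn n f"
| "recursive_fn (length gs) f \<Longrightarrow> (\<forall>g \<in> set gs. recursive_fn n g) \<Longrightarrow>
     recursive_fn n (\<lambda>xs. f (map (\<lambda>g. g xs) gs))"
| "recursive_fn (Suc n) f \<Longrightarrow> (\<forall>xs. length xs = n \<longrightarrow> (\<exists>y. f (y # xs) = 0)) \<Longrightarrow>
     recursive_fn n (\<lambda>xs. LEAST y. f (y # xs) = 0)"

definition primrec1 :: "(nat \<Rightarrow> nat) \<Rightarrow> bool" where
  "primrec1 f \<longleftrightarrow> (\<exists>F. primrec_fn 1 F \<and> (\<forall>x. f x = F [x]))"

definition primrec2 :: "(nat \<Rightarrow> nat \<Rightarrow> nat) \<Rightarrow> bool" where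
  "primrec2 f \<longleftrightarrow> (\<exists>F. primrec_fn 2 F \<and> (\<forall>x y. f x y = F [x, y]))"

definition recursive1 :: "(nat \<Rightarrow> nat) \<Rightarrow> bool" where
  "recursive1 f \<longleftrightarrow> (\<exists>F. recursive_fn 1 F \<and> (\<forall>x. f x = F [x]))"

primrec gn_tm :: "tm \<Rightarrow> nat" where
  "gn_tm (Var x) = prod_encode (0, x)"
| "gn_tm Zero = prod_encode (1, 0)"
| "gn_tm (Succ t) = prod_encode (2, gn_tm t)"
| "gn_tm (Add s t) = prod_encode (3, prod_encode (gn_tm s, gn_tm t))"
| "gn_tm (Mul s t) = prod_encode (4, prod_encode (gn_tm s, gn_tm t))"

primrec gn_fm :: "fm \<Rightarrow> nat" where
  "gn_fm (Eq s t) = prod_encode (0, prod_encode (gn_tm s, gn_tm t))"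
| "gn_fm Fls = prod_encode (1, 0)"
| "gn_fm (Con \<phi> \<psi>) = prod_encode (2, prod_encode (gn_fm \<phi>, gn_fm \<psi>))"
| "gn_fm (Imp \<phi> \<psi>) = prod_encode (3, prod_encode (gn_fm \<phi>, gn_fm \<psi>))"
| "gn_fm (Forall x \<phi>) = prod_encode (4, prod_encode (x, gn_fm \<phi>))"

text \<open>The effective numberings are those that can be translated recursively to and from the
  reference numbering \<open>gn_fm\<close>. Injectivity, and decidability of the set of codes, follow.\<close>

definition effective_numbering :: "(fm \<Rightarrow> nat) \<Rightarrow> bool" where
  "effective_numbering code \<longleftrightarrow>
     (\<exists>f g. recursive1 f \<and> recursive1 g \<and> (\<forall>\<phi>. code \<phi> = f (gn_fm \<phi>) \<and> g (code \<phi>) = gn_fm \<phi>))"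


section \<open>Theories\<close>

primrec teval :: "(nat \<Rightarrow> nat) \<Rightarrow> tm \<Rightarrow> nat" where
  "teval e (Var x) = e x"
| "teval e Zero = 0"
| "teval e (Succ t) = Suc (teval e t)"
| "teval e (Add s t) = teval e s + teval e t"
| "teval e (Mul s t) = teval e s * teval e t"

primrec holds :: "(nat \<Rightarrow> nat) \<Rightarrow> fm \<Rightarrow> bool" where
  "holds e (Eq s t) \<longleftrightarrow> teval e s = teval e t"
| "holds e Fls \<longleftrightarrow> False"
| "holds e (Con \<phi> \<psi>) \<longleftrightarrow> holds e \<phi> \<and> holds e \<psi>"
| "holds e (Imp \<phi> \<psi>) \<longleftrightarrow> (holds e \<phi> \<longrightarrow> holds e \<psi>)"
| "holds e (Forall x \<phi>) \<longleftrightarrow> (\<forall>n. holds (e(x := n)) \<phi>)"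

text \<open>An arithmetic theory is about the natural numbers to the extent that it proves no
  \<open>\<Delta>\<^sub>0\<close>-sentence that is false of them. Every consistent extension of Robinson arithmetic
  satisfies this, sound or not. Together with the two conditions of \<open>sufficiently_strong\<close> it says
  that exactly the true \<open>\<Delta>\<^sub>0\<close>-sentences are provable. Those two conditions alone do not imply it:
  they leave open, for instance, that \<open>Mul Zero Zero\<close> provably differs from every numeral.\<close>

definition arithmetic_theory :: "fm set \<Rightarrow> bool" where
  "arithmetic_theory A \<longleftrightarrow>
     (\<forall>\<alpha> \<in> A. sentence \<alpha>) \<and>
     (\<forall>\<delta>. delta0 \<delta> \<longrightarrow> sentence \<delta> \<longrightarrow> A \<turnstile> \<delta> \<longrightarrow> (\<forall>e. holds e \<delta>))"

definition sufficiently_strong :: "fm set \<Rightarrow> bool" where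
  "sufficiently_strong A \<longleftrightarrow>
     (\<forall>m n. A \<turnstile> Eq (num m) (num n) \<longleftrightarrow> m = n) \<and>
     (\<forall>\<delta>. delta0 \<delta> \<longrightarrow> sentence \<delta> \<longrightarrow> A \<turnstile> \<delta> \<or> A \<turnstile> Neg \<delta>)"

definition recursively_axiomatizable :: "(fm \<Rightarrow> nat) \<Rightarrow> fm set \<Rightarrow> bool" where
  "recursively_axiomatizable code A \<longleftrightarrow> (\<exists>f. primrec1 f \<and> range f = code ` A)"


section \<open>The provability predicate\<close>

text \<open>\<open>seq_of p\<close> is the sequence coded by \<open>p\<close>, if any. The terms \<open>elt_bound\<close> and \<open>len_bound\<close>, in the
  variable \<open>0\<close> standing for \<open>p\<close>, are the bounds put on the quantifiers over elements and over the
  length of the sequence coded by \<open>p\<close>.\<close>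

record coding =
  code :: "fm \<Rightarrow> nat"
  seq_of :: "nat \<Rightarrow> nat list option"
  pref :: "nat \<Rightarrow> nat \<Rightarrow> nat"
  FormF :: fm
  SeqF :: fm
  EltF :: fm
  AxF :: fm
  MPF :: fm
  GenF :: fm
  elt_bound :: tm
  len_bound :: tm

abbreviation quote :: "coding \<Rightarrow> fm \<Rightarrow> tm" where
  "quote K \<phi> \<equiv> num (code K \<phi>)"

text \<open>Variables: \<open>p = 0\<close>, \<open>x = 1\<close>, \<open>n = 2\<close>, \<open>i = 3\<close>, \<open>y = 4\<close>, \<open>j = 5\<close>, \<open>k = 6\<close>, \<open>y\<^sub>1 = 7\<close>, \<open>y\<^sub>2 = 8\<close>;
  \<open>9\<close> is the witness variable of \<open><\<close>, and \<open>10\<close> is the predecessor of \<open>n\<close> in \<open>Prf\<close>.\<close>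

definition Line :: "coding \<Rightarrow> fm" where
  "Line K =
     Exists_less 9 4 (elt_bound K)
       (Con (app (EltF K) [Var 0, Var 3, Var 4])
       (Con (app (FormF K) [Var 4])
       (Dis (app (AxF K) [Var 4])
       (Dis (Exists_less 9 5 (Var 3) (Exists_less 9 6 (Var 3)
               (Exists_less 9 7 (elt_bound K) (Exists_less 9 8 (elt_bound K)
                 (Con (app (EltF K) [Var 0, Var 5, Var 7])
                 (Con (app (EltF K) [Var 0, Var 6, Var 8])
                      (app (MPF K) [Var 7, Var 8, Var 4])))))))
            (Exists_less 9 5 (Var 3) (Exists_less 9 7 (elt_bound K)
               (Con (app (EltF K) [Var 0, Var 5, Var 7])
                    (app (GenF K) [Var 7, Var 4]))))))))"

definition Prf :: "coding \<Rightarrow> fm" where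
  "Prf K =
     Con (app (FormF K) [Var 1])
       (Exists_less 9 2 (len_bound K)
         (Con (app (SeqF K) [Var 0, Var 2])
         (Con (Less 9 Zero (Var 2))
         (Con (Exists_less 9 10 (Var 2)
                (Con (Eq (Succ (Var 10)) (Var 2)) (app (EltF K) [Var 0, Var 10, Var 1])))
              (Forall_less 9 3 (Var 2) (Line K))))))"

definition Prov :: "coding \<Rightarrow> fm" where
  "Prov K = Exists 0 (Prf K)"

definition delta0_coding :: "coding \<Rightarrow> bool" where
  "delta0_coding K \<longleftrightarrow>
     (\<forall>\<phi> \<in> {FormF K, SeqF K, EltF K, AxF K, MPF K, GenF K}. delta0 \<phi>) \<and>
     fv (FormF K) \<subseteq> {..<1} \<and> fv (SeqF K) \<subseteq> {..<2} \<and> fv (EltF K) \<subseteq> {..<3} \<and>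
     fv (AxF K) \<subseteq> {..<1} \<and> fv (MPF K) \<subseteq> {..<3} \<and> fv (GenF K) \<subseteq> {..<2} \<and>
     tvars (elt_bound K) \<subseteq> {0} \<and> tvars (len_bound K) \<subseteq> {0}"

definition comp_cond :: "fm set \<Rightarrow> coding \<Rightarrow> bool" where
  "comp_cond A K \<longleftrightarrow> (\<forall>\<phi> \<psi>. A \<turnstile> Eq (quote K \<phi>) (quote K \<psi>) \<longleftrightarrow> \<phi> = \<psi>)"

definition seq_cond :: "fm set \<Rightarrow> coding \<Rightarrow> bool" where
  "seq_cond A K \<longleftrightarrow>
     (\<forall>xs. \<exists>p. seq_of K p = Some xs) \<and>
     (\<forall>p n. A \<turnstile> app (SeqF K) [num p, num n] \<longleftrightarrow>
        (\<exists>xs. seq_of K p = Some xs \<and> length xs = n)) \<and>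
     (\<forall>p i y. A \<turnstile> app (EltF K) [num p, num i, num y] \<longleftrightarrow>
        (\<exists>xs. seq_of K p = Some xs \<and> i < length xs \<and> xs ! i = y)) \<and>
     (\<forall>p i. A \<turnstile> Forall 0 (Forall 1
        (Imp (Con (app (EltF K) [num p, num i, Var 0]) (app (EltF K) [num p, num i, Var 1]))
             (Eq (Var 0) (Var 1))))) \<and>
     (\<forall>p n i. i < n \<longrightarrow> A \<turnstile> Imp (app (SeqF K) [num p, num n])
        (Exists 0 (Con (app (EltF K) [num p, num i, Var 0])
                   (Forall 1 (Imp (app (EltF K) [num p, num i, Var 1]) (Eq (Var 1) (Var 0)))))))"

definition rule_cond :: "fm set \<Rightarrow> coding \<Rightarrow> bool" where
  "rule_cond A K \<longleftrightarrow>
     (\<forall>n. A \<turnstile> app (FormF K) [num n] \<longleftrightarrow> (\<exists>\<phi>. n = code K \<phi>)) \<and>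
     (\<forall>n. A \<turnstile> app (AxF K) [num n] \<longleftrightarrow> (\<exists>\<phi> \<in> axioms_of A. n = code K \<phi>)) \<and>
     (\<forall>a b c. A \<turnstile> app (MPF K) [num a, num b, num c] \<longleftrightarrow>
        (\<exists>\<phi> \<psi>. a = code K \<phi> \<and> b = code K (Imp \<phi> \<psi>) \<and> c = code K \<psi>)) \<and>
     (\<forall>a c. A \<turnstile> app (GenF K) [num a, num c] \<longleftrightarrow>
        (\<exists>\<phi> x. a = code K \<phi> \<and> c = code K (Forall x \<phi>)))"

definition pref_cond :: "fm set \<Rightarrow> coding \<Rightarrow> bool" where
  "pref_cond A K \<longleftrightarrow>
     primrec2 (pref K) \<and>
     (\<forall>p k xs. seq_of K p = Some xs \<longrightarrow> k \<le> length xs \<longrightarrow>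
        seq_of K (pref K p k) = Some (take k xs) \<and>
        A \<turnstile> app (SeqF K) [num (pref K p k), num k]) \<and>
     (\<forall>p n \<phi> \<psi>. A \<turnstile>
        Imp (Con (app (Prf K) [num p, quote K \<phi>]) (app (EltF K) [num p, num n, quote K \<psi>]))
            (app (Prf K) [num (pref K p (n + 1)), quote K \<psi>]))"

definition bound_cond :: "fm set \<Rightarrow> coding \<Rightarrow> bool" where
  "bound_cond A K \<longleftrightarrow>
     (\<forall>p i y. A \<turnstile> Imp (app (EltF K) [num p, num i, num y])
        (Less 0 (num y) (tsub (\<lambda>_. num p) (elt_bound K)))) \<and>
     (\<forall>p n. A \<turnstile> Imp (app (SeqF K) [num p, num n])
        (Less 0 (num n) (tsub (\<lambda>_. num p) (len_bound K))))"

definition standard_coding :: "fm set \<Rightarrow> coding \<Rightarrow> bool" where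
  "standard_coding A K \<longleftrightarrow>
     effective_numbering (code K) \<and> delta0_coding K \<and>
     comp_cond A K \<and> seq_cond A K \<and> rule_cond A K \<and> pref_cond A K \<and> bound_cond A K"

end

theory Submission imports Defs begin

text \<open>For every closed term \<open>t\<close> the sentence \<open>Prf(t, \<phi>)\<close> is \<open>\<Delta>\<^sub>0\<close>, hence decided by \<open>A\<close>. If
  some \<open>Prf(t, \<phi>)\<close> is provable, it is true, the value of \<open>t\<close> codes an actual derivation of \<open>\<phi>\<close>,
  and \<open>\<phi>\<close> is supported because classical logic is sound for support. Otherwise a base supporting
  \<open>A\<close> supports every \<open>\<not> Prf(t, \<phi>)\<close>, that is, \<open>\<forall>p. \<not> Prf(p, \<phi>)\<close>, as the quantifier ranges over
  closed terms only; together with \<open>Prov(\<phi>)\<close> it supports \<open>\<bottom>\<close>, and so everything.\<close>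

section \<open>Substitution\<close>

lemma tsub_cong: "(\<And>v. v \<in> tvars t \<Longrightarrow> \<sigma> v = \<tau> v) \<Longrightarrow> tsub \<sigma> t = tsub \<tau> t"
  by (induction t) auto

lemma tsub_tsub: "tsub \<sigma> (tsub \<tau> t) = tsub (\<lambda>v. tsub \<sigma> (\<tau> v)) t"
  by (induction t) auto

lemma tsub_Var [simp]: "tsub Var t = t"
  by (induction t) auto

lemma tsub_closed: "closed_tm t \<Longrightarrow> tsub \<sigma> t = t"
  using tsub_cong[of t \<sigma> Var] by (simp add: closed_tm_def)

lemma tvars_tsub: "tvars (tsub \<sigma> t) = (\<Union>v \<in> tvars t. tvars (\<sigma> v))"
  by (induction t) auto

lemma tvars_num [simp]: "tvars (num n) = {}"
  by (induction n) auto

lemma finite_tvars [simp]: "finite (tvars t)"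
  by (induction t) auto

lemma finite_fv [simp]: "finite (fv \<phi>)"
  by (induction \<phi>) auto

text \<open>Only finitely many variables occur in the substituted terms, so a fresh name exists;
  when nothing is renamed, \<open>x\<close> itself is absent from them.\<close>

lemma bvar_fresh:
  assumes "v \<in> fv \<phi>" "v \<noteq> x"
  shows "bvar \<sigma> x \<phi> \<notin> tvars (\<sigma> v)"
proof -
  define V where "V = (\<Union>v \<in> fv \<phi> - {x}. tvars (\<sigma> v))"
  have "finite V"
    by (simp add: V_def)
  then have "(LEAST z. z \<notin> V) \<notin> V"
    using ex_new_if_finite infinite_UNIV_nat LeastI_ex[of "\<lambda>z. z \<notin> V"] by blast
  then have "bvar \<sigma> x \<phi> \<notin> V"
    by (simp add: bvar_def V_def[symmetric] Let_def)
  then show ?thesis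
    using assms by (auto simp: V_def)
qed

lemma bvar_eq:
  assumes "\<And>v. v \<in> fv \<phi> \<Longrightarrow> v \<noteq> x \<Longrightarrow> x \<notin> tvars (\<sigma> v)"
  shows "bvar \<sigma> x \<phi> = x"
  using assms by (auto simp: bvar_def Let_def)

lemma bvar_cong:
  assumes "\<And>v. v \<in> fv \<phi> \<Longrightarrow> v \<noteq> x \<Longrightarrow> \<sigma> v = \<tau> v"
  shows "bvar \<sigma> x \<phi> = bvar \<tau> x \<phi>"
proof -
  have "(\<Union>v \<in> fv \<phi> - {x}. tvars (\<sigma> v)) = (\<Union>v \<in> fv \<phi> - {x}. tvars (\<tau> v))"
    using assms by auto
  then show ?thesis
    by (simp add: bvar_def)
qed

lemma sub_cong: "(\<And>v. v \<in> fv \<phi> \<Longrightarrow> \<sigma> v = \<tau> v) \<Longrightarrow> sub \<sigma> \<phi> = sub \<tau> \<phi>"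
proof (induction \<phi> arbitrary: \<sigma> \<tau>)
  case (Eq s t)
  then show ?case
    using tsub_cong[of s \<sigma> \<tau>] tsub_cong[of t \<sigma> \<tau>] by simp
next
  case (Con \<phi>1 \<phi>2)
  show ?case
    using Con.IH[of \<sigma> \<tau>] Con.prems by simp
next
  case (Imp \<phi>1 \<phi>2)
  show ?case
    using Imp.IH[of \<sigma> \<tau>] Imp.prems by simp
next
  case (Forall x \<phi>)
  have "bvar \<sigma> x \<phi> = bvar \<tau> x \<phi>"
    using Forall.prems by (intro bvar_cong) auto
  moreover have "sub (\<sigma>(x := u)) \<phi> = sub (\<tau>(x := u)) \<phi>" for u
    using Forall.prems by (intro Forall.IH) auto
  ultimately show ?case
    by simp
qed simp

lemma sub_Var [simp]: "sub Var \<phi> = \<phi>"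
  by (induction \<phi>) (auto simp: bvar_eq)

lemma sub_sentence: "sentence \<phi> \<Longrightarrow> sub \<sigma> \<phi> = \<phi>"
  using sub_cong[of \<phi> \<sigma> Var] by (simp add: sentence_def)

lemma fv_sub: "fv (sub \<sigma> \<phi>) = (\<Union>v \<in> fv \<phi>. tvars (\<sigma> v))"
proof (induction \<phi> arbitrary: \<sigma>)
  case (Forall x \<phi>)
  show ?case
    using bvar_fresh[of _ \<phi> x \<sigma>] by (fastforce simp: Forall.IH split: if_splits)
qed (auto simp: tvars_tsub)

lemma sentence_sub_closed: "(\<And>v. v \<in> fv \<phi> \<Longrightarrow> closed_tm (\<sigma> v)) \<Longrightarrow> sentence (sub \<sigma> \<phi>)"
  by (simp add: sentence_def fv_sub closed_tm_def)

text \<open>Composition of substitutions is an identity of formulas only when no bound variable gets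
  renamed.\<close>

definition grounding :: "(nat \<Rightarrow> tm) \<Rightarrow> bool" where
  "grounding \<sigma> \<longleftrightarrow> (\<forall>v. closed_tm (\<sigma> v) \<or> \<sigma> v = Var v)"

lemma grounding_upd: "grounding \<sigma> \<Longrightarrow> closed_tm t \<or> t = Var x \<Longrightarrow> grounding (\<sigma>(x := t))"
  by (auto simp: grounding_def)

text \<open>Capture is impossible: a closed term contains no variable, and \<open>Var v\<close> with
  \<open>v\<close> other than \<open>x\<close> does not contain \<open>x\<close>.\<close>

lemma sub_grounding_Forall:
  assumes "grounding \<sigma>"
  shows "sub \<sigma> (Forall x \<phi>) = Forall x (sub (\<sigma>(x := Var x)) \<phi>)"
proof -
  have "bvar \<sigma> x \<phi> = x"
    using assms by (intro bvar_eq) (force simp: grounding_def closed_tm_def)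
  then show ?thesis
    by simp
qed

lemma sub_sub_grounding:
  "grounding \<sigma> \<Longrightarrow> grounding \<tau> \<Longrightarrow> sub \<tau> (sub \<sigma> \<phi>) = sub (\<lambda>v. tsub \<tau> (\<sigma> v)) \<phi>"
proof (induction \<phi> arbitrary: \<sigma> \<tau>)
  case (Forall x \<phi>)
  let ?\<sigma> = "\<sigma>(x := Var x)" and ?\<tau> = "\<tau>(x := Var x)"
  \<comment> \<open>For \<open>v\<close> other than \<open>x\<close> the update of
    \<open>\<tau>\<close> is invisible, since \<open>\<sigma> v\<close> is closed or
    \<open>Var v\<close> and so avoids \<open>x\<close>.\<close>
  have comp: "(\<lambda>v. tsub ?\<tau> (?\<sigma> v)) = (\<lambda>v. tsub \<tau> (\<sigma> v))(x := Var x)"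
  proof
    fix v
    have "closed_tm (\<sigma> v) \<or> \<sigma> v = Var v"
      using Forall.prems by (simp add: grounding_def)
    then show "tsub ?\<tau> (?\<sigma> v) = ((\<lambda>v. tsub \<tau> (\<sigma> v))(x := Var x)) v"
      by (auto simp: tsub_closed)
  qed
  have g: "grounding (\<lambda>v. tsub \<tau> (\<sigma> v))"
    using Forall.prems by (auto simp: grounding_def) (metis tsub.simps(1) tsub_closed)
  have "sub \<tau> (sub \<sigma> (Forall x \<phi>)) = Forall x (sub ?\<tau> (sub ?\<sigma> \<phi>))"
    by (simp only: sub_grounding_Forall Forall.prems)
  also have "\<dots> = Forall x (sub (\<lambda>v. tsub ?\<tau> (?\<sigma> v)) \<phi>)"
    by (subst Forall.IH) (simp_all only: grounding_upd Forall.prems simp_thms)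
  also have "\<dots> = sub (\<lambda>v. tsub \<tau> (\<sigma> v)) (Forall x \<phi>)"
    by (simp only: comp sub_grounding_Forall[OF g])
  finally show ?case .
qed (auto simp: tsub_tsub)


section \<open>Soundness of classical logic for support\<close>

text \<open>Support of a closed instance, with the assignment kept apart from the formula. Instances
  commute with support, whereas \<open>sub \<sigma> (sub \<tau> \<phi>)\<close> may differ from any \<open>sub \<rho> \<phi>\<close> in its
  bound variables.\<close>

primrec sat :: "fm \<Rightarrow> atomic_rule set \<Rightarrow> (nat \<Rightarrow> tm) \<Rightarrow> bool" where
  "sat (Eq s t) B \<sigma> \<longleftrightarrow> base_derives B (Eq (tsub \<sigma> s) (tsub \<sigma> t))"
| "sat Fls B \<sigma> \<longleftrightarrow> (\<forall>P. closed_atom P \<longrightarrow> base_derives B P)"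
| "sat (Con \<phi> \<psi>) B \<sigma> \<longleftrightarrow> sat \<phi> B \<sigma> \<and> sat \<psi> B \<sigma>"
| "sat (Imp \<phi> \<psi>) B \<sigma> \<longleftrightarrow> (\<forall>C. is_base C \<and> B \<subseteq> C \<longrightarrow> sat \<phi> C \<sigma> \<longrightarrow> sat \<psi> C \<sigma>)"
| "sat (Forall x \<phi>) B \<sigma> \<longleftrightarrow> (\<forall>t. closed_tm t \<longrightarrow> sat \<phi> B (\<sigma>(x := t)))"

abbreviation closed_asg :: "(nat \<Rightarrow> tm) \<Rightarrow> bool" where
  "closed_asg \<sigma> \<equiv> \<forall>v. closed_tm (\<sigma> v)"

section \<open>Invariance of \<open>sat\<close> and its agreement with support\<close>

lemma closed_tm_tsub: "closed_asg \<sigma> \<Longrightarrow> closed_tm (tsub \<sigma> t)"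
  by (simp add: closed_tm_def tvars_tsub)

lemma sat_cong: "(\<And>v. v \<in> fv \<phi> \<Longrightarrow> \<sigma> v = \<tau> v) \<Longrightarrow> sat \<phi> B \<sigma> = sat \<phi> B \<tau>"
proof (induction \<phi> arbitrary: B \<sigma> \<tau>)
  case (Eq s t)
  then show ?case
    using tsub_cong[of s \<sigma> \<tau>] tsub_cong[of t \<sigma> \<tau>] by simp
next
  case (Con \<phi>1 \<phi>2)
  show ?case
    using Con.IH[of \<sigma> \<tau>] Con.prems by simp
next
  case (Imp \<phi>1 \<phi>2)
  show ?case
    using Imp.IH[of \<sigma> \<tau>] Imp.prems by simp
next
  case (Forall x \<phi>)
  have "sat \<phi> B (\<sigma>(x := u)) = sat \<phi> B (\<tau>(x := u))" for u
    using Forall.prems by (intro Forall.IH) auto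
  then show ?case
    by simp
qed simp

text \<open>Here \<open>\<tau>\<close> may force renaming: \<open>sat\<close> does not see the names
  of bound variables, and freshness of the chosen name hides the update made under the
  binder.\<close>

lemma sat_sub: "sat (sub \<tau> \<phi>) B \<sigma> = sat \<phi> B (\<lambda>v. tsub \<sigma> (\<tau> v))"
proof (induction \<phi> arbitrary: B \<sigma> \<tau>)
  case (Forall x \<phi>)
  let ?z = "bvar \<tau> x \<phi>"
  have "sat \<phi> B (\<lambda>v. tsub (\<sigma>(?z := t)) ((\<tau>(x := Var ?z)) v))
      = sat \<phi> B ((\<lambda>v. tsub \<sigma> (\<tau> v))(x := t))" for t
  proof (rule sat_cong)
    fix v
    assume "v \<in> fv \<phi>"
    then show "tsub (\<sigma>(?z := t)) ((\<tau>(x := Var ?z)) v) = ((\<lambda>v. tsub \<sigma> (\<tau> v))(x := t)) v"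
      using bvar_fresh[of v \<phi> x \<tau>] by (auto intro!: tsub_cong)
  qed
  then show ?case
    by (simp add: Forall.IH fun_upd_def)
qed (auto simp: tsub_tsub)

text \<open>A closed assignment renames nothing, so instantiating the bound variable afterwards is a
  single update of \<open>\<sigma>\<close>, as in the \<open>Forall\<close> clause of
  \<open>sat\<close>.\<close>

lemma supports_sub: "closed_asg \<sigma> \<Longrightarrow> supports B (sub \<sigma> \<phi>) = sat \<phi> B \<sigma>"
proof (induction \<phi> arbitrary: B \<sigma>)
  case (Forall x \<phi>)
  have g: "grounding \<sigma>"
    using Forall.prems by (simp add: grounding_def)
  have "subst1 (sub (\<sigma>(x := Var x)) \<phi>) x t = sub (\<sigma>(x := t)) \<phi>" if "closed_tm t" for t
  proof -
    have gt: "grounding (Var(x := t))"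
      using that by (simp add: grounding_def)
    have "(\<lambda>v. tsub (Var(x := t)) ((\<sigma>(x := Var x)) v)) = \<sigma>(x := t)"
      using Forall.prems by (auto simp: tsub_closed)
    then show ?thesis
      using sub_sub_grounding[OF grounding_upd[OF g] gt, of "Var x" x \<phi>] by simp
  qed
  then show ?case
    using Forall by (simp add: sub_grounding_Forall[OF g] fun_upd_def del: sub.simps)
qed auto

lemma supports_sentence: "sentence \<phi> \<Longrightarrow> closed_asg \<sigma> \<Longrightarrow> supports B \<phi> = sat \<phi> B \<sigma>"
  using supports_sub[of \<sigma> B \<phi>] by (simp add: sub_sentence)

section \<open>Persistence under extension of bases, and classical negation\<close>

lemma base_derives_mono: "base_derives B P \<Longrightarrow> B \<subseteq> C \<Longrightarrow> base_derives C P"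
  by (induction rule: base_derives.induct) (auto intro: base_derives.intros)

lemma sat_mono: "sat \<phi> B \<sigma> \<Longrightarrow> B \<subseteq> C \<Longrightarrow> sat \<phi> C \<sigma>"
proof (induction \<phi> arbitrary: \<sigma>)
  case (Imp \<phi>1 \<phi>2)
  then show ?case
    by (meson order_trans sat.simps(4))
qed (auto intro: base_derives_mono)

lemma sat_ImpD: "sat (Imp \<phi> \<psi>) B \<sigma> \<Longrightarrow> is_base B \<Longrightarrow> sat \<phi> B \<sigma> \<Longrightarrow> sat \<psi> B \<sigma>"
  by simp

lemma sat_NegI:
  "(\<And>C. is_base C \<Longrightarrow> B \<subseteq> C \<Longrightarrow> sat \<phi> C \<sigma> \<Longrightarrow> sat Fls C \<sigma>) \<Longrightarrow> sat (Neg \<phi>) B \<sigma>"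
  by (simp add: Neg_def)

lemma sat_NegD: "sat (Neg \<phi>) B \<sigma> \<Longrightarrow> is_base C \<Longrightarrow> B \<subseteq> C \<Longrightarrow> sat \<phi> C \<sigma> \<Longrightarrow> sat Fls C \<sigma>"
  by (simp add: Neg_def)

lemma sat_Fls_asg: "sat Fls B \<sigma> \<Longrightarrow> sat Fls B \<tau>"
  by simp

text \<open>All added rules have the single premise \<open>P\<close>. Where one is first used,
  \<open>P\<close> is already derivable in \<open>B\<close>; without such a use the derivation lies
  in \<open>B\<close>.\<close>

lemma base_derives_explosive:
  assumes "base_derives (B \<union> {([P], Q) | Q. closed_atom Q}) R"
  shows "base_derives B R \<or> base_derives B P"
  using assms
proof (induction rule: base_derives.induct)
  case (1 Ps C)
  show ?case
  proof (cases "(Ps, C) \<in> B")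
    case True
    then show ?thesis
      using 1 by (meson base_derives.intros)
  next
    case False
    then show ?thesis
      using 1 by auto
  qed
qed

text \<open>In the atomic case, extend the base by rules inferring every atom from \<open>P\<close>: this supports
  \<open>\<not> P\<close> and derives \<open>P\<close> only if the original base does.\<close>

lemma sat_double_negation:
  "is_base B \<Longrightarrow> closed_asg \<sigma> \<Longrightarrow> sat (Neg (Neg \<phi>)) B \<sigma> \<Longrightarrow> sat \<phi> B \<sigma>"
proof (induction \<phi> arbitrary: B \<sigma>)
  case (Eq s t)
  define P where "P = Eq (tsub \<sigma> s) (tsub \<sigma> t)"
  define C where "C = B \<union> {([P], Q) | Q. closed_atom Q}"
  have P: "closed_atom P"
    using closed_tm_tsub[OF Eq.prems(2)]
    by (simp add: P_def closed_atom_def sentence_def closed_tm_def)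
  have "is_base C"
    using Eq.prems(1) P by (auto simp: C_def is_base_def)
  moreover have "sat (Neg (Eq s t)) C \<sigma>"
  proof (rule sat_NegI)
    fix D
    assume "C \<subseteq> D" and P_D: "sat (Eq s t) D \<sigma>"
    then have "base_derives D Q" if "closed_atom Q" for Q
      using that by (intro base_derives.intros[of "[P]" Q]) (auto simp: C_def P_def)
    then show "sat Fls D \<sigma>"
      by simp
  qed
  ultimately have "sat Fls C \<sigma>"
    using Eq.prems(3) sat_NegD[of "Neg (Eq s t)" B \<sigma> C] by (auto simp: C_def)
  then have "base_derives C P"
    using P by simp
  then have "base_derives B P"
    using base_derives_explosive unfolding C_def by blast
  then show ?case
    by (simp add: P_def)
next
  case Fls
  have "sat (Neg Fls) B \<sigma>"
    by (rule sat_NegI)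
  then show ?case
    using Fls sat_NegD by blast
next
  case (Con \<phi> \<psi>)
  \<comment> \<open>An extension supporting the negation of one conjunct supports the negation of
    the conjunction, and hence \<open>Fls\<close>.\<close>
  have "sat (Neg (Neg \<phi>)) B \<sigma>" "sat (Neg (Neg \<psi>)) B \<sigma>"
    using Con.prems(3) unfolding Neg_def sat.simps(3,4) by (meson order_trans order_refl)+
  then show ?case
    using Con by simp
next
  case (Imp \<phi> \<psi>)
  have "sat \<psi> C \<sigma>" if C: "is_base C" "B \<subseteq> C" "sat \<phi> C \<sigma>" for C
  proof (rule Imp.IH(2)[OF C(1) Imp.prems(2)], rule sat_NegI)
    fix D
    assume D: "is_base D" "C \<subseteq> D" "sat (Neg \<psi>) D \<sigma>"
    \<comment> \<open>\<open>\<phi>\<close> persists from \<open>C\<close>, so an extension of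
      \<open>D\<close> supporting the implication also supports \<open>\<psi>\<close>, against
      \<open>Neg \<psi>\<close>.\<close>
    have "sat (Neg (Imp \<phi> \<psi>)) D \<sigma>"
    proof (rule sat_NegI)
      fix E
      assume E: "is_base E" "D \<subseteq> E" "sat (Imp \<phi> \<psi>) E \<sigma>"
      then have "sat \<psi> E \<sigma>"
        using sat_mono[OF C(3), of E] D(2) by (auto intro: sat_ImpD)
      then show "sat Fls E \<sigma>"
        using sat_NegD[OF D(3)] E by blast
    qed
    then show "sat Fls D \<sigma>"
      using sat_NegD[OF Imp.prems(3), of D] D C by blast
  qed
  then show ?case
    by simp
next
  case (Forall x \<phi>)
  have "sat \<phi> B (\<sigma>(x := t))" if t: "closed_tm t" for t
  proof (rule Forall.IH[OF Forall.prems(1)], simp add: t Forall.prems(2), rule sat_NegI)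
    fix D
    assume D: "is_base D" "B \<subseteq> D" "sat (Neg \<phi>) D (\<sigma>(x := t))"
    \<comment> \<open>The instance at \<open>t\<close> contradicts \<open>Neg \<phi>\<close>; as
      \<open>Fls\<close> has no variables, the absurdity passes between
      \<open>\<sigma>(x := t)\<close> and \<open>\<sigma>\<close>.\<close>
    have "sat (Neg (Forall x \<phi>)) D \<sigma>"
    proof (rule sat_NegI)
      fix E
      assume E: "is_base E" "D \<subseteq> E" "sat (Forall x \<phi>) E \<sigma>"
      then have "sat Fls E (\<sigma>(x := t))"
        using sat_NegD[OF D(3), of E] t by simp
      then show "sat Fls E \<sigma>"
        by (rule sat_Fls_asg)
    qed
    then have "sat Fls D \<sigma>"
      using sat_NegD[OF Forall.prems(3), of D] D by blast
    then show "sat Fls D (\<sigma>(x := t))"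
      by (rule sat_Fls_asg)
  qed
  then show ?case
    by simp
qed

text \<open>\<open>Fls\<close> persists to all extensions, which gives
  \<open>Neg (Neg \<phi>)\<close>; double negation elimination thus lifts explosion from atoms to
  all formulas.\<close>

lemma sat_ex_falso: "is_base B \<Longrightarrow> closed_asg \<sigma> \<Longrightarrow> sat Fls B \<sigma> \<Longrightarrow> sat \<phi> B \<sigma>"
  by (rule sat_double_negation) (simp_all add: sat_NegI sat_mono[of Fls, simplified])

lemma sat_logical_axioms:
  assumes "\<phi> \<in> logical_axioms" "is_base B" "closed_asg \<sigma>"
  shows "sat \<phi> B \<sigma>"
  using assms
proof (induction rule: logical_axioms.induct)
  case (1 \<phi> \<psi>)
  then show ?case
    using sat_mono by auto
next
  case (2 \<phi> \<psi> \<chi>)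
  then show ?case
    unfolding sat.simps by (meson order_refl order_trans)
next
  case (3 \<phi> \<psi>)
  then show ?case
    using sat_mono by auto
next
  case (6 \<phi>)
  then show ?case
    using sat_double_negation by simp
next
  case (7 x \<phi> t)
  have "sat (subst1 \<phi> x t) C \<sigma>" if "sat (Forall x \<phi>) C \<sigma>" for C
  proof -
    \<comment> \<open>The term \<open>t\<close> may be open; under \<open>\<sigma>\<close> it
      becomes the closed term \<open>tsub \<sigma> t\<close>, which is the instance to take.\<close>
    have "(\<lambda>v. tsub \<sigma> ((Var(x := t)) v)) = \<sigma>(x := tsub \<sigma> t)"
      by auto
    then show ?thesis
      using that closed_tm_tsub[OF 7(2), of t] by (simp add: sat_sub)
  qed
  then show ?case
    by simp
next
  case (8 x \<phi> \<psi>)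
  have "sat \<phi> C (\<sigma>(x := t)) = sat \<phi> C \<sigma>" for C t
    using 8(1) by (intro sat_cong) auto
  then show ?case
    by auto
qed auto

text \<open>Derivations pass through open formulas, so the claim covers all closed assignments, as
  the generalization case requires. On the axioms of \<open>A\<close>, which are sentences,
  \<open>sat\<close> and support agree.\<close>

lemma soundness:
  assumes "A \<turnstile> \<psi>" "is_base B" "\<And>\<alpha>. \<alpha> \<in> A \<Longrightarrow> sentence \<alpha>" "\<And>\<alpha>. \<alpha> \<in> A \<Longrightarrow> supports B \<alpha>"
    "closed_asg \<sigma>"
  shows "sat \<psi> B \<sigma>"
  using assms(1,5)
proof (induction arbitrary: \<sigma> rule: proves.induct)
  case (ax \<phi>)
  then show ?case
    using assms(2-4) sat_logical_axioms supports_sentence by (auto simp: axioms_of_def)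
next
  case (mp \<phi> \<psi>)
  then show ?case
    using sat_ImpD assms(2) by blast
qed auto


section \<open>Arithmetic truth\<close>

lemma teval_cong: "(\<And>v. v \<in> tvars t \<Longrightarrow> e v = e' v) \<Longrightarrow> teval e t = teval e' t"
  by (induction t) auto

lemma teval_num [simp]: "teval e (num n) = n"
  by (induction n) auto

lemma teval_tsub: "teval e (tsub \<tau> t) = teval (\<lambda>v. teval e (\<tau> v)) t"
  by (induction t) auto

lemma holds_cong: "(\<And>v. v \<in> fv \<phi> \<Longrightarrow> e v = e' v) \<Longrightarrow> holds e \<phi> = holds e' \<phi>"
proof (induction \<phi> arbitrary: e e')
  case (Eq s t)
  then show ?case
    using teval_cong[of s e e'] teval_cong[of t e e'] by simp
next
  case (Con \<phi>1 \<phi>2)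
  show ?case
    using Con.IH[of e e'] Con.prems by simp
next
  case (Imp \<phi>1 \<phi>2)
  show ?case
    using Imp.IH[of e e'] Imp.prems by simp
next
  case (Forall x \<phi>)
  have "holds (e(x := u)) \<phi> = holds (e'(x := u)) \<phi>" for u
    using Forall.prems by (intro Forall.IH) auto
  then show ?case
    by simp
qed simp

lemma holds_sub: "holds e (sub \<tau> \<phi>) = holds (\<lambda>v. teval e (\<tau> v)) \<phi>"
proof (induction \<phi> arbitrary: e \<tau>)
  case (Forall x \<phi>)
  let ?z = "bvar \<tau> x \<phi>"
  have "holds (\<lambda>v. teval (e(?z := n)) ((\<tau>(x := Var ?z)) v)) \<phi>
      = holds ((\<lambda>v. teval e (\<tau> v))(x := n)) \<phi>" for n
  proof (rule holds_cong)
    fix v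
    assume "v \<in> fv \<phi>"
    then show "teval (e(?z := n)) ((\<tau>(x := Var ?z)) v) = ((\<lambda>v. teval e (\<tau> v))(x := n)) v"
      using bvar_fresh[of v \<phi> x \<tau>] by (auto intro!: teval_cong)
  qed
  then show ?case
    by (simp add: Forall.IH fun_upd_def)
qed (auto simp: teval_tsub)

lemma holds_Neg [simp]: "holds e (Neg \<phi>) \<longleftrightarrow> \<not> holds e \<phi>"
  by (simp add: Neg_def)

lemma holds_Dis [simp]: "holds e (Dis \<phi> \<psi>) \<longleftrightarrow> holds e \<phi> \<or> holds e \<psi>"
  by (simp add: Dis_def)

lemma holds_Less [simp]:
  assumes "z \<notin> tvars s \<union> tvars t"
  shows "holds e (Less z s t) \<longleftrightarrow> teval e s < teval e t"
proof -
  have "teval (e(z := n)) s = teval e s" "teval (e(z := n)) t = teval e t" for n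
    using assms by (auto intro: teval_cong)
  then show ?thesis
    by (simp add: Less_def Exists_def) (metis add_Suc_right less_natE less_add_Suc1)
qed

lemma holds_Forall_less [simp]:
  assumes "x \<notin> tvars t" "z \<notin> tvars t" "z \<noteq> x"
  shows "holds e (Forall_less z x t \<phi>) \<longleftrightarrow> (\<forall>n < teval e t. holds (e(x := n)) \<phi>)"
proof -
  have "teval (e(x := n)) t = teval e t" for n
    using assms by (auto intro: teval_cong)
  then show ?thesis
    using assms by (simp add: Forall_less_def)
qed

lemma holds_Exists_less [simp]:
  assumes "x \<notin> tvars t" "z \<notin> tvars t" "z \<noteq> x"
  shows "holds e (Exists_less z x t \<phi>) \<longleftrightarrow> (\<exists>n < teval e t. holds (e(x := n)) \<phi>)"
  using assms by (simp add: Exists_less_def)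


section \<open>Bounded formulas\<close>

lemma delta0_Neg: "delta0 \<phi> \<Longrightarrow> delta0 (Neg \<phi>)"
  by (simp add: Neg_def delta0.intros)

lemma delta0_Dis: "delta0 \<phi> \<Longrightarrow> delta0 \<psi> \<Longrightarrow> delta0 (Dis \<phi> \<psi>)"
  by (simp add: Dis_def delta0_Neg delta0.intros)

lemma delta0_Exists_less:
  "x \<notin> tvars t \<Longrightarrow> z \<notin> tvars t \<Longrightarrow> z \<noteq> x \<Longrightarrow> delta0 \<phi> \<Longrightarrow> delta0 (Exists_less z x t \<phi>)"
  by (simp add: Exists_less_def delta0_Neg delta0.intros)

text \<open>Substitution may rename the hidden witness variable, so the inequality is recovered only
  up to the choice of a fresh witness.\<close>

lemma sub_Less:
  assumes "z \<notin> tvars s \<union> tvars t"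
  obtains z' where "z' \<notin> tvars (tsub \<sigma> s) \<union> tvars (tsub \<sigma> t)"
    and "sub \<sigma> (Less z s t) = Less z' (tsub \<sigma> s) (tsub \<sigma> t)"
proof -
  define \<psi> where "\<psi> = Neg (Eq (Add s (Succ (Var z))) t)"
  define z' where "z' = bvar \<sigma> z \<psi>"
  have fv: "fv \<psi> = insert z (tvars s \<union> tvars t)"
    by (auto simp: \<psi>_def Neg_def)
  have "z' \<notin> tvars (\<sigma> v)" if "v \<in> tvars s \<union> tvars t" for v
    using bvar_fresh[of v \<psi> z \<sigma>] that assms by (auto simp: fv z'_def)
  then have "z' \<notin> tvars (tsub \<sigma> s) \<union> tvars (tsub \<sigma> t)"
    by (auto simp: tvars_tsub)
  moreover have "tsub (\<sigma>(z := u)) s = tsub \<sigma> s" "tsub (\<sigma>(z := u)) t = tsub \<sigma> t" for u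
    using assms by (auto intro: tsub_cong)
  then have "sub \<sigma> (Less z s t) = Less z' (tsub \<sigma> s) (tsub \<sigma> t)"
    by (simp add: Less_def Exists_def z'_def \<psi>_def Neg_def)
  ultimately show ?thesis
    using that by blast
qed

text \<open>Both the bounded variable and the hidden witness may be renamed; their new names avoid
  the substituted bound, so the quantifier stays bounded.\<close>

lemma delta0_sub: "delta0 \<phi> \<Longrightarrow> delta0 (sub \<sigma> \<phi>)"
proof (induction arbitrary: \<sigma> rule: delta0.induct)
  case (3 z s t)
  then show ?case
    by (metis sub_Less delta0.intros(3))
next
  case (6 x t z \<phi>)
  define \<psi> where "\<psi> = Imp (Less z (Var x) t) \<phi>"
  define x' where "x' = bvar \<sigma> x \<psi>"
  define \<tau> where "\<tau> = \<sigma>(x := Var x')"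
  \<comment> \<open>Since \<open>z\<close> is not in \<open>t\<close>, every variable of the bound
    is free in the scope of \<open>x\<close>; the new name \<open>x'\<close> is therefore fresh for
    the substituted bound.\<close>
  have "tvars t - {z} \<subseteq> fv \<psi>"
    by (auto simp: \<psi>_def Less_def Exists_def Neg_def)
  then have "x' \<notin> tvars (\<sigma> v)" if "v \<in> tvars t" for v
    using bvar_fresh[of v \<psi> x \<sigma>] that 6(1,2) unfolding x'_def by blast
  then have x': "x' \<notin> tvars (tsub \<sigma> t)"
    by (auto simp: tvars_tsub)
  have t: "tsub \<tau> t = tsub \<sigma> t"
    using 6(1) by (auto simp: \<tau>_def intro: tsub_cong)
  obtain z' where z': "z' \<notin> {x'} \<union> tvars (tsub \<sigma> t)"
      "sub \<tau> (Less z (Var x) t) = Less z' (Var x') (tsub \<sigma> t)"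
    using sub_Less[of z "Var x" t \<tau>] 6(2,3) t by (auto simp: \<tau>_def)
  have "sub \<sigma> (Forall_less z x t \<phi>) = Forall_less z' x' (tsub \<sigma> t) (sub \<tau> \<phi>)"
    using z'(2) by (simp add: Forall_less_def \<psi>_def[symmetric] x'_def[symmetric] \<tau>_def[symmetric])
      (simp add: \<psi>_def)
  then show ?case
    using x' z'(1) 6 by (simp add: delta0.intros)
qed (auto intro: delta0.intros)

lemma delta0_app: "delta0 \<phi> \<Longrightarrow> delta0 (app \<phi> ts)"
  by (simp add: app_def delta0_sub)

lemma delta0_Prf:
  assumes "delta0_coding K"
  shows "delta0 (Prf K)"
proof -
  \<comment> \<open>\<open>elt_bound K\<close> and \<open>len_bound K\<close> contain at most the
    variable 0, the proof code, while \<open>Prf\<close> binds only variables from 2 on.\<close>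
  have b: "v \<notin> tvars (elt_bound K)" "v \<notin> tvars (len_bound K)" if "v \<noteq> 0" for v
    using assms that by (auto simp: delta0_coding_def)
  have "delta0 (app \<phi> ts)" if "\<phi> \<in> {FormF K, SeqF K, EltF K, AxF K, MPF K, GenF K}" for \<phi> ts
    using assms that by (auto simp: delta0_coding_def intro: delta0_app)
  then show ?thesis
    unfolding Prf_def Line_def
    by (intro delta0.intros delta0_Dis delta0_Exists_less) (auto simp: b)
qed


section \<open>Free variables of the provability predicate\<close>

lemma fv_app:
  "fv \<phi> \<subseteq> {..<length ts} \<Longrightarrow> fv (app \<phi> ts) \<subseteq> (\<Union>t \<in> set ts. tvars t)"
  by (fastforce simp: app_def fv_sub)

text \<open>Ensures that inserting a numeral for variable 1 yields a sentence, whose support can be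
  read off from any closed assignment.\<close>

lemma fv_Prov:
  assumes "delta0_coding K"
  shows "fv (Prov K) \<subseteq> {1}"
proof -
  have b: "tvars (elt_bound K) \<subseteq> {0}" "tvars (len_bound K) \<subseteq> {0}"
    using assms by (auto simp: delta0_coding_def)
  have 1: "fv (app (FormF K) [t]) \<subseteq> tvars t" "fv (app (AxF K) [t]) \<subseteq> tvars t" for t
    using assms fv_app[of "FormF K" "[t]"] fv_app[of "AxF K" "[t]"]
    by (simp_all add: delta0_coding_def)
  have 2: "fv (app (SeqF K) [s, t]) \<subseteq> tvars s \<union> tvars t"
      "fv (app (GenF K) [s, t]) \<subseteq> tvars s \<union> tvars t" for s t
    using assms fv_app[of "SeqF K" "[s, t]"] fv_app[of "GenF K" "[s, t]"]
    by (simp_all add: delta0_coding_def numeral_2_eq_2)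
  have 3: "fv (app (EltF K) [r, s, t]) \<subseteq> tvars r \<union> tvars s \<union> tvars t"
      "fv (app (MPF K) [r, s, t]) \<subseteq> tvars r \<union> tvars s \<union> tvars t" for r s t
    using assms fv_app[of "EltF K" "[r, s, t]"] fv_app[of "MPF K" "[r, s, t]"]
    by (simp_all add: delta0_coding_def numeral_3_eq_3 Un_assoc)
  have [simp]: "fv (Neg \<phi>) = fv \<phi>" "fv (Dis \<phi> \<psi>) = fv \<phi> \<union> fv \<psi>"
      "fv (Exists x \<phi>) = fv \<phi> - {x}" for x \<phi> \<psi>
    by (auto simp: Neg_def Dis_def Exists_def)
  have [simp]: "fv (Less z s t) = tvars s \<union> tvars t - {z}"
      "fv (Forall_less z x t \<phi>) = (insert x (tvars t) - {z} \<union> fv \<phi>) - {x}"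
      "fv (Exists_less z x t \<phi>) = (insert x (tvars t) - {z} \<union> fv \<phi>) - {x}" for z x s t \<phi>
    by (auto simp: Less_def Forall_less_def Exists_less_def)
  have "fv (Line K) \<subseteq> {0, 3}"
    unfolding Line_def using b 1[of "Var 4"] 2(2)[of "Var 7" "Var 4"]
      3(1)[of "Var 0" "Var 3" "Var 4"] 3(1)[of "Var 0" "Var 5" "Var 7"]
      3(1)[of "Var 0" "Var 6" "Var 8"] 3(2)[of "Var 7" "Var 8" "Var 4"]
    by auto
  then show ?thesis
    unfolding Prov_def Prf_def
    using b 1(1)[of "Var 1"] 2(1)[of "Var 0" "Var 2"] 3(1)[of "Var 0" "Var 10" "Var 1"]
    by auto
qed


section \<open>Derivations coded in the theory\<close>

text \<open>Provable \<open>\<Delta>\<^sub>0\<close>-sentences are true. Conversely, if a true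
  \<open>\<delta>\<close> were unprovable, \<open>A\<close> would prove \<open>Neg \<delta>\<close>,
  which is again \<open>\<Delta>\<^sub>0\<close> but false.\<close>

lemma delta0_proves_iff:
  assumes "arithmetic_theory A" "sufficiently_strong A" "delta0 \<delta>" "sentence \<delta>"
  shows "A \<turnstile> \<delta> \<longleftrightarrow> holds e \<delta>"
proof -
  have "delta0 (Neg \<delta>)" "sentence (Neg \<delta>)"
    using assms by (simp_all add: delta0_Neg) (simp add: sentence_def Neg_def)
  then show ?thesis
    using assms unfolding arithmetic_theory_def sufficiently_strong_def by (metis holds_Neg)
qed

text \<open>The coding conditions speak of provability at numerals. Replacing each argument by the
  numeral of its value turns them into truth conditions for arbitrary terms.\<close>

lemma holds_app_iff:
  assumes "arithmetic_theory A" "sufficiently_strong A" "delta0 \<phi>" "fv \<phi> \<subseteq> {..<length ts}"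
  shows "holds e (app \<phi> ts) \<longleftrightarrow> A \<turnstile> app \<phi> (map (\<lambda>t. num (teval e t)) ts)"
proof -
  let ?ns = "map (\<lambda>t. num (teval e t)) ts"
  have "sentence (app \<phi> ?ns)"
    unfolding app_def using assms(4) by (intro sentence_sub_closed) (auto simp: closed_tm_def)
  then have "A \<turnstile> app \<phi> ?ns \<longleftrightarrow> holds e (app \<phi> ?ns)"
    using assms by (intro delta0_proves_iff delta0_app)
  also have "\<dots> \<longleftrightarrow> holds e (app \<phi> ts)"
    unfolding app_def holds_sub using assms(4) by (intro holds_cong) auto
  finally show ?thesis ..
qed

text \<open>Truth of \<open>Prf\<close> makes the value of variable 0 the code of an actual list of
  numbers whose entries are codes of derivation lines.\<close>

lemma holds_Prf_imp_proves:
  assumes "arithmetic_theory A" "sufficiently_strong A" "standard_coding A K"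
    and prf_e: "holds e (Prf K)" and e1: "e 1 = code K \<phi>"
  shows "A \<turnstile> \<phi>"
proof -
  have cod: "delta0_coding K" "comp_cond A K" "seq_cond A K" "rule_cond A K"
    using assms(3) by (auto simp: standard_coding_def)
  \<comment> \<open>Equal codes give the equation of a numeral with itself, which \<open>A\<close>
    proves, so \<open>comp_cond\<close> applies.\<close>
  have inj: "\<phi> = \<psi>" if "code K \<phi> = code K \<psi>" for \<phi> \<psi>
    using that cod(2) assms(2) by (metis comp_cond_def sufficiently_strong_def)
  have bnd: "v \<notin> tvars (elt_bound K)" "v \<notin> tvars (len_bound K)" if "v \<noteq> 0" for v
    using cod(1) that by (auto simp: delta0_coding_def)
  note app = holds_app_iff[OF assms(1,2)]
  have Form: "holds e (app (FormF K) [t]) \<longleftrightarrow> (\<exists>\<phi>. teval e t = code K \<phi>)" for e t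
    using app[of "FormF K" "[t]" e] cod(1,4) by (simp add: delta0_coding_def rule_cond_def)
  have Ax: "holds e (app (AxF K) [t]) \<longleftrightarrow> (\<exists>\<phi> \<in> axioms_of A. teval e t = code K \<phi>)" for e t
    using app[of "AxF K" "[t]" e] cod(1,4) by (simp add: delta0_coding_def rule_cond_def)
  have MP: "holds e (app (MPF K) [r, s, t]) \<longleftrightarrow>
      (\<exists>\<phi> \<psi>. teval e r = code K \<phi> \<and> teval e s = code K (Imp \<phi> \<psi>) \<and> teval e t = code K \<psi>)"
    for e r s t
    using app[of "MPF K" "[r, s, t]" e] cod(1,4)
    by (simp add: delta0_coding_def rule_cond_def numeral_3_eq_3)
  have Gen: "holds e (app (GenF K) [s, t]) \<longleftrightarrow>
      (\<exists>\<phi> x. teval e s = code K \<phi> \<and> teval e t = code K (Forall x \<phi>))" for e s t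
    using app[of "GenF K" "[s, t]" e] cod(1,4)
    by (simp add: delta0_coding_def rule_cond_def numeral_2_eq_2)
  have Seq: "holds e (app (SeqF K) [s, t]) \<longleftrightarrow>
      (\<exists>xs. seq_of K (teval e s) = Some xs \<and> length xs = teval e t)" for e s t
    using app[of "SeqF K" "[s, t]" e] cod(1,3)
    by (simp add: delta0_coding_def seq_cond_def numeral_2_eq_2)
  have Elt: "holds e (app (EltF K) [r, s, t]) \<longleftrightarrow> (\<exists>xs. seq_of K (teval e r) = Some xs \<and>
      teval e s < length xs \<and> xs ! teval e s = teval e t)" for e r s t
    using app[of "EltF K" "[r, s, t]" e] cod(1,3)
    by (simp add: delta0_coding_def seq_cond_def numeral_3_eq_3)
  \<comment> \<open>\<open>m\<close> is the value of variable 10, the predecessor of the length, so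
    that \<open>\<phi>\<close> is the last line.\<close>
  obtain xs m where xs: "seq_of K (e 0) = Some xs" "Suc m = length xs" "xs ! m = code K \<phi>"
    and line: "\<forall>i < length xs. holds (e(2 := length xs, 3 := i)) (Line K)"
    using prf_e unfolding Prf_def by (auto simp: bnd Seq Elt e1[simplified])
  \<comment> \<open>Strong induction on the position, as modus ponens and generalization refer to
    earlier lines; \<open>inj\<close> identifies the formula coded by each entry.\<close>
  have "\<forall>\<psi>. xs ! i = code K \<psi> \<longrightarrow> A \<turnstile> \<psi>" if "i < length xs" for i
    using that
  proof (induction i rule: less_induct)
    case (less i)
    from line less.prems have "holds (e(2 := length xs, 3 := i)) (Line K)"
      by blast
    then consider
        \<theta> where "\<theta> \<in> axioms_of A" "xs ! i = code K \<theta>"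
      | j k \<theta> \<chi> where "j < i" "k < i" "xs ! j = code K \<theta>" "xs ! k = code K (Imp \<theta> \<chi>)"
          "xs ! i = code K \<chi>"
      | j \<theta> x where "j < i" "xs ! j = code K \<theta>" "code K (Forall x \<theta>) = xs ! i"
      unfolding Line_def by (auto simp: bnd Form Ax MP Gen Elt xs(1))
    then show ?case
    proof cases
      case (1 \<theta>)
      then show ?thesis
        using inj proves.ax by metis
    next
      case (2 j k \<theta> \<chi>)
      then have "A \<turnstile> \<theta>" "A \<turnstile> Imp \<theta> \<chi>"
        using less by (meson less_trans)+
      then show ?thesis
        using inj proves.mp 2(5) by metis
    next
      case (3 j \<theta> x)
      then have "A \<turnstile> \<theta>"
        using less by (meson less_trans)
      then show ?thesis
        using inj proves.gen 3(3) by metis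
    qed
  qed
  then show ?thesis
    using xs(2,3) by (metis lessI)
qed

text \<open>The case distinction runs over closed terms instead of numerals, matching the support
  clause for \<open>Forall\<close>; no closed term has to be exchanged for a numeral inside the
  base.\<close>

lemma supports_Prov_imp_supports:
  assumes "arithmetic_theory A" "sufficiently_strong A" "standard_coding A K" "sentence \<phi>"
    and C: "is_base C" "\<And>\<alpha>. \<alpha> \<in> A \<Longrightarrow> supports C \<alpha>"
    and prov: "supports C (subst1 (Prov K) 1 (quote K \<phi>))"
  shows "supports C \<phi>"
proof -
  \<comment> \<open>Variable 1 receives the code of \<open>\<phi>\<close>; the value
    \<open>Zero\<close> elsewhere keeps the assignment closed.\<close>
  define \<sigma> where "\<sigma> = (\<lambda>v::nat. Zero)(1 := quote K \<phi>)"
  have \<sigma>: "closed_asg \<sigma>"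
    by (simp add: \<sigma>_def closed_tm_def)
  have sound: "sat \<psi> C \<tau>" if "A \<turnstile> \<psi>" "closed_asg \<tau>" for \<psi> \<tau>
    using soundness[OF that(1) C(1) _ C(2) that(2)] assms(1) by (simp add: arithmetic_theory_def)
  have "sat \<phi> C \<sigma>"
  proof (cases "\<exists>t. closed_tm t \<and> A \<turnstile> sub (\<sigma>(0 := t)) (Prf K)")
    case True
    then obtain t where t: "closed_tm t" "A \<turnstile> sub (\<sigma>(0 := t)) (Prf K)"
      by blast
    \<comment> \<open>The provable instance is true; by \<open>holds_sub\<close> the number
      \<open>teval (\<lambda>v. 0) t\<close> then serves as the proof code.\<close>
    have "holds (\<lambda>v. 0) (sub (\<sigma>(0 := t)) (Prf K))"
    proof (rule delta0_proves_iff[THEN iffD1])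
      show "delta0 (sub (\<sigma>(0 := t)) (Prf K))"
        using assms(3) by (simp add: delta0_sub delta0_Prf standard_coding_def)
      show "sentence (sub (\<sigma>(0 := t)) (Prf K))"
        using \<sigma> t by (simp add: sentence_sub_closed)
    qed (use assms t in auto)
    then have "A \<turnstile> \<phi>"
      unfolding holds_sub
      by (rule holds_Prf_imp_proves[OF assms(1-3)]) (simp add: \<sigma>_def)
    then show ?thesis
      using sound \<sigma> by blast
  next
    case False
    have "sat (Neg (Prf K)) C (\<sigma>(0 := t))" if t: "closed_tm t" for t
    proof -
      let ?\<delta> = "sub (\<sigma>(0 := t)) (Prf K)"
      have "delta0 ?\<delta>" "sentence ?\<delta>"
        using assms(3) \<sigma> t
        by (simp_all add: delta0_sub delta0_Prf standard_coding_def sentence_sub_closed)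
      then have "A \<turnstile> Neg ?\<delta>"
        using False t assms(2) by (auto simp: sufficiently_strong_def)
      then have "A \<turnstile> sub (\<sigma>(0 := t)) (Neg (Prf K))"
        by (simp add: Neg_def)
      moreover have "closed_asg (\<sigma>(0 := t))"
        using \<sigma> t by simp
      \<comment> \<open>The assignment enters twice, through the substituted sentence and through
        \<open>sat\<close>; its values being closed, the two collapse into one.\<close>
      ultimately have "sat (Neg (Prf K)) C (\<lambda>v. tsub (\<sigma>(0 := t)) ((\<sigma>(0 := t)) v))"
        using sound sat_sub by blast
      moreover have "(\<lambda>v. tsub (\<sigma>(0 := t)) ((\<sigma>(0 := t)) v)) = \<sigma>(0 := t)"
        using \<sigma> t by (auto simp: tsub_closed)
      ultimately show ?thesis
        by simp
    qed
    then have "sat (Forall 0 (Neg (Prf K))) C \<sigma>"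
      by simp
    moreover have "sat (Prov K) C \<sigma>"
    proof -
      \<comment> \<open>Evaluating the substituted sentence under the constant assignment
        \<open>Zero\<close> amounts to evaluating \<open>Prov K\<close> under
        \<open>\<sigma>\<close>.\<close>
      have "(\<lambda>v. tsub (\<lambda>_. Zero) ((Var(1 := quote K \<phi>)) v)) = \<sigma>"
        by (auto simp: \<sigma>_def tsub_closed closed_tm_def)
      moreover have "sentence (subst1 (Prov K) 1 (quote K \<phi>))"
        using fv_Prov[of K] assms(3)
        by (intro sentence_sub_closed) (auto simp: standard_coding_def closed_tm_def)
      ultimately show ?thesis
        using prov supports_sentence[of _ "\<lambda>_. Zero" C] sat_sub[of _ "Prov K" C "\<lambda>_. Zero"]
        by (metis closed_tm_def tvars.simps(2))
    qed
    ultimately have "sat Fls C \<sigma>"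
      using sat_NegD[OF _ C(1) order_refl] by (simp add: Prov_def Exists_def)
    then show ?thesis
      by (rule sat_ex_falso[OF C(1) \<sigma>])
  qed
  then show ?thesis
    using supports_sentence[OF assms(4) \<sigma>] by simp
qed

theorem theorem15:
  fixes A :: "fm set" and K :: coding and \<phi> :: fm
  assumes "arithmetic_theory A"
    and "recursively_axiomatizable (code K) A"
    and "sufficiently_strong A"
    and "standard_coding A K"
    and "sentence \<phi>"
  shows "valid A (Imp (subst1 (Prov K) 1 (quote K \<phi>)) \<phi>)"
proof -
  \<comment> \<open>\<open>C\<close> is the base supporting \<open>A\<close>, and \<open>D\<close>
    the further extension introduced by the implication; the axioms persist from \<open>C\<close> to
    \<open>D\<close>.\<close>
  have "supports D \<phi>"
    if "is_base C" "\<forall>\<alpha> \<in> A. supports C \<alpha>" "is_base D" "C \<subseteq> D"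
      "supports D (subst1 (Prov K) 1 (quote K \<phi>))" for C D
  proof (rule supports_Prov_imp_supports[OF assms(1,3-5) that(3) _ that(5)])
    fix \<alpha>
    assume "\<alpha> \<in> A"
    then have "sentence \<alpha>" "supports C \<alpha>"
      using assms(1) that(2) by (auto simp: arithmetic_theory_def)
    then show "supports D \<alpha>"
      using supports_sentence[of \<alpha> "\<lambda>_. Zero"] sat_mono[OF _ that(4)]
      by (simp add: closed_tm_def)
  qed
  then show ?thesis
    by (auto simp: valid_def entails_def)
qed

end
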